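(* Let $1\le p<\infty$, let $\Omega$ be a compact Hausdorff space, let $X,Y$ be Banach spaces and let $T:C(\Omega,X)\to Y$ be a strongly bounded operator with extension $\hat T:B(\Omega,X)\to Y$. Then the adjoint $T^*$ is Dunford-Pettis $p$-convergent if and only if the adjoint $\hat T^*$ is Dunford-Pettis $p$-convergent.
   Context: A sequence $(x_n)_n$ in a Banach space $X$ is weakly $p$-summable if $(x^*(x_n))_n\in\ell_p$ for every $x^*\in X^*$. A bounded set $K\subseteq X$ is a Dunford-Pettis set if every weakly null sequence $(x_n^* )_n$ in $X^*$ converges to $0$ uniformly on $K$. A bounded linear operator between Banach spaces is Dunford-Pettis $p$-convergent if it takes every weakly $p$-summable sequence whose set of terms is a Dunford-Pettis set to a norm null sequence. $C(\Omega,X)$ is the space of continuous functions $\Omega\to X$ with the supremum norm; $\Sigma$ is the $\sigma$-algebra of Borel subsets of $\Omega$; $B(\Omega,X)$ is the space of all bounded $\Sigma$-measurable functions $\Omega\to X$ with separable range, with the supremum norm, regarded as a subspace of $C(\Omega,X)^{**}$ via integration against the elements of $C(\Omega,X)^*$ (regular $X^*$-valued Borel measures of bounded variation). Every bounded linear operator $T:C(\Omega,X)\to Y$ has a representing measure $m:\Sigma\to L(X,Y^{**})$ of finite semivariation $\tilde m$ with $T(f)=\int_\Omega f\,dm$, where $\tilde m(A)=\sup\|\sum_i m(A_i)x_i\|$ over finite Borel partitions $(A_i)$ of $A$ and $x_i$ in the unit ball of $X$. $T$ is strongly bounded if $m$ is, i.e. $\tilde m(A_n)\to0$ for every pairwise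 disjoint sequence $(A_n)$ in $\Sigma$; in this case $m$ takes values in $L(X,Y)$. For strongly bounded $T$, $\hat T:B(\Omega,X)\to Y$ is the restriction of $T^{**}$ to $B(\Omega,X)$, i.e. $\hat T(f)=\int_\Omega f\,dm$. *)

theory Defs
  imports "HOL-Analysis.Analysis"
begin

section \<open>The space of bounded Borel functions with separable range\<close>

(* Without separability of the ranges, a sum of two Borel functions need not be Borel, since
   the values lie in an arbitrary normed space. *)

lemma separable_space_range_iff:
  fixes f :: "'o \<Rightarrow> 'x::metric_space"
  shows "separable_space (top_of_set (range f)) \<longleftrightarrow>
    (\<exists>D. countable D \<and> D \<subseteq> range f \<and> range f \<subseteq> closure D)"
proof -
  have "top_of_set (range f) closure_of D = range f \<longleftrightarrow> range f \<subseteq> closure D"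
    if "D \<subseteq> range f" for D
    using that by (auto simp: closure_of_subtopology Int_absorb1)
  then show ?thesis
    unfolding separable_space_def by auto
qed

lemma separable_range_approx:
  fixes f :: "'o \<Rightarrow> 'x::metric_space"
  assumes "separable_space (top_of_set (range f))"
  shows "\<exists>D. countable D \<and> (\<forall>x. \<forall>e>0. \<exists>d\<in>D. dist d (f x) < e)"
proof -
  obtain D where "countable D" "range f \<subseteq> closure D"
    using assms unfolding separable_space_range_iff by blast
  then have "\<forall>x. \<forall>e>0. \<exists>d\<in>D. dist d (f x) < e"
    using closure_approachable[of _ D] by blast
  then show ?thesis
    using \<open>countable D\<close> by blast
qed

lemma separable_rangeI:
  fixes f :: "'o \<Rightarrow> 'x::metric_space"
  assumes D: "countable D" "\<And>x e. e > 0 \<Longrightarrow> \<exists>d\<in>D. dist d (f x) < e"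
  shows "separable_space (top_of_set (range f))"
proof -
  define P where "P = {(d, n::nat) |d n. d \<in> D \<and> (\<exists>x. dist d (f x) < 1 / Suc n)}"
  define c where "c = (\<lambda>(d, n::nat). f (SOME x. dist d (f x) < 1 / Suc n))"
  have "P \<subseteq> D \<times> UNIV"
    by (auto simp: P_def)
  then have "countable (c ` P)"
    using D(1) countable_subset[of P "D \<times> UNIV"] by (intro countable_image) simp
  moreover have "c ` P \<subseteq> range f"
    by (auto simp: c_def)
  moreover have "f x \<in> closure (c ` P)" for x
    unfolding closure_approachable
  proof (intro allI impI)
    fix e :: real assume "e > 0"
    then obtain n where n: "1 / Suc n < e / 2"
      using nat_approx_posE[of "e / 2"] by auto
    obtain d where d: "d \<in> D" "dist d (f x) < 1 / Suc n"
      using D(2)[of "1 / Suc n" x] by auto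
    have "dist d (c (d, n)) < 1 / Suc n"
      using someI[of "\<lambda>x. dist d (f x) < 1 / Suc n", OF d(2)] by (simp add: c_def)
    then have "dist (c (d, n)) (f x) < e"
      using d(2) n dist_triangle3[of "c (d, n)" "f x" d] by linarith
    moreover have "(d, n) \<in> P"
      using d by (auto simp: P_def)
    ultimately show "\<exists>y\<in>c ` P. dist y (f x) < e"
      by blast
  qed
  ultimately show ?thesis
    unfolding separable_space_range_iff by blast
qed

definition bmeasfun :: "('o::topological_space \<Rightarrow> 'x::real_normed_vector) set" where
  "bmeasfun = {f. f \<in> borel_measurable borel \<and> bounded (range f) \<and>
                  separable_space (top_of_set (range f))}"

lemma bmeasfun_const: "(\<lambda>_. c) \<in> bmeasfun"
  using separable_rangeI[of "{c}" "\<lambda>_. c"] by (simp add: bmeasfun_def)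

lemma bmeasfun_scaleR:
  assumes "f \<in> bmeasfun" shows "(\<lambda>x. r *\<^sub>R f x) \<in> bmeasfun"
proof -
  have meas: "(\<lambda>x. r *\<^sub>R f x) \<in> borel_measurable borel"
    using assms
    by (intro borel_measurable_continuous_on[of "\<lambda>y. r *\<^sub>R y" f]) (auto simp: bmeasfun_def intro!: continuous_intros)
  obtain D where D: "countable D" "\<And>x e. e > 0 \<Longrightarrow> \<exists>d\<in>D. dist d (f x) < e"
    using assms separable_range_approx[of f] by (auto simp: bmeasfun_def)
  have "separable_space (top_of_set (range (\<lambda>x. r *\<^sub>R f x)))"
  proof (rule separable_rangeI[of "(\<lambda>d. r *\<^sub>R d) ` D"])
    fix x and e :: real assume "e > 0"
    then obtain d where d: "d \<in> D" "dist d (f x) < e / (\<bar>r\<bar> + 1)"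
      using D(2)[of "e / (\<bar>r\<bar> + 1)" x] by (auto simp: divide_pos_pos add_nonneg_pos)
    have "dist (r *\<^sub>R d) (r *\<^sub>R f x) = \<bar>r\<bar> * dist d (f x)"
      by (simp add: dist_norm flip: scaleR_diff_right)
    also have "\<dots> \<le> \<bar>r\<bar> * (e / (\<bar>r\<bar> + 1))"
      using d by (intro mult_left_mono) auto
    also have "\<dots> < e"
      using \<open>e > 0\<close> by (simp add: field_simps add_nonneg_pos)
    finally show "\<exists>d\<in>(\<lambda>d. r *\<^sub>R d) ` D. dist d (r *\<^sub>R f x) < e"
      using d(1) by blast
  qed (use D(1) in auto)
  moreover have "bounded (range (\<lambda>x. r *\<^sub>R f x))"
    using assms by (auto simp: bmeasfun_def intro!: bounded_scaleR_comp)
  ultimately show ?thesis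
    using meas by (auto simp: bmeasfun_def)
qed

lemma bmeasfun_plus:
  assumes f: "f \<in> bmeasfun" and g: "g \<in> bmeasfun"
  shows "(\<lambda>x. f x + g x) \<in> bmeasfun"
proof -
  have [measurable]: "f \<in> borel_measurable borel" "g \<in> borel_measurable borel"
    using assms by (auto simp: bmeasfun_def)
  obtain D where D: "countable D" "\<And>x e. e > 0 \<Longrightarrow> \<exists>d\<in>D. dist d (f x) < e"
    using f separable_range_approx[of f] by (auto simp: bmeasfun_def)
  obtain E where E: "countable E" "\<And>x e. e > 0 \<Longrightarrow> \<exists>d\<in>E. dist d (g x) < e"
    using g separable_range_approx[of g] by (auto simp: bmeasfun_def)
  have "separable_space (top_of_set (range (\<lambda>x. f x + g x)))"
  proof (rule separable_rangeI[of "(\<lambda>(d, e). d + e) ` (D \<times> E)"])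
    fix x and e :: real assume "e > 0"
    then obtain d d' where d: "d \<in> D" "dist d (f x) < e / 2" "d' \<in> E" "dist d' (g x) < e / 2"
      using D(2)[of "e / 2" x] E(2)[of "e / 2" x] by auto
    then have "dist (d + d') (f x + g x) < e"
      using dist_triangle_add[of d d' "f x" "g x"] by simp
    then show "\<exists>y\<in>(\<lambda>(d, e). d + e) ` (D \<times> E). dist y (f x + g x) < e"
      using d by force
  qed (use D(1) E(1) in auto)
  moreover have "(\<lambda>x. f x + g x) \<in> borel_measurable borel"
  proof (rule borel_measurableI)
    fix S :: "'b set" assume S: "open S"
    define J where "J = {(d, e, n::nat). d \<in> D \<and> e \<in> E \<and> ball (d + e) (2 / Suc n) \<subseteq> S}"
    define B where
      "B = (\<lambda>(d, e, n::nat). f -` ball d (1 / Suc n) \<inter> g -` ball e (1 / Suc n))"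
    have "J \<subseteq> D \<times> E \<times> UNIV"
      by (auto simp: J_def)
    then have "countable J"
      using D(1) E(1) countable_subset[of J "D \<times> E \<times> UNIV"] by simp
    moreover have "B j \<in> sets borel" for j
      using measurable_sets[of f borel borel] measurable_sets[of g borel borel]
      by (auto simp: B_def split: prod.split intro!: sets.Int)
    ultimately have "(\<Union>j\<in>J. B j) \<in> sets borel"
      by (intro sets.countable_UN') auto
    moreover have "(\<lambda>x. f x + g x) -` S = (\<Union>j\<in>J. B j)"
    proof (intro equalityI subsetI)
      fix x assume "x \<in> (\<lambda>x. f x + g x) -` S"
      then obtain r where r: "r > 0" "ball (f x + g x) r \<subseteq> S"
        using S by (auto simp: open_contains_ball)
      obtain n where n: "1 / Suc n < r / 4"
        using nat_approx_posE[of "r / 4"] r(1) by auto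
      obtain d e where de: "d \<in> D" "dist d (f x) < 1 / Suc n" "e \<in> E" "dist e (g x) < 1 / Suc n"
        using D(2)[of "1 / Suc n" x] E(2)[of "1 / Suc n" x] by auto
      have "ball (d + e) (2 / Suc n) \<subseteq> ball (f x + g x) r"
      proof
        fix y assume "y \<in> ball (d + e) (2 / Suc n)"
        then have "dist (d + e) y < 2 * (1 / Suc n)"
          by simp
        moreover have "dist (d + e) (f x + g x) < 2 * (1 / Suc n)"
          using dist_triangle_add[of d e "f x" "g x"] de by linarith
        ultimately have "dist (f x + g x) y < r"
          using dist_triangle3[of "f x + g x" y "d + e"] n by linarith
        then show "y \<in> ball (f x + g x) r"
          by simp
      qed
      then have "(d, e, n) \<in> J"
        using de r by (auto simp: J_def)
      moreover have "x \<in> B (d, e, n)"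
        using de by (auto simp: B_def)
      ultimately show "x \<in> (\<Union>j\<in>J. B j)"
        by blast
    next
      fix x assume "x \<in> (\<Union>j\<in>J. B j)"
      then obtain d e n where j: "ball (d + e) (2 / Suc n) \<subseteq> S"
        "dist d (f x) < 1 / Suc n" "dist e (g x) < 1 / Suc n"
        by (auto simp: J_def B_def)
      then have "dist (d + e) (f x + g x) < 2 * (1 / Suc n)"
        using dist_triangle_add[of d e "f x" "g x"] by linarith
      then show "x \<in> (\<lambda>x. f x + g x) -` S"
        using j(1) by auto
    qed
    ultimately show "(\<lambda>x. f x + g x) -` S \<inter> space borel \<in> sets borel"
      by simp
  qed
  ultimately show ?thesis
    using assms by (auto simp: bmeasfun_def intro!: bounded_plus_comp)
qed

typedef (overloaded) ('o, 'x) bmeasfun =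
  "bmeasfun :: ('o::topological_space \<Rightarrow> 'x::real_normed_vector) set"
  morphisms apply_bmeasfun Bmeasfun
  using bmeasfun_const by blast

setup_lifting type_definition_bmeasfun

lemma bmeasfun_eqI: "(\<And>x. apply_bmeasfun f x = apply_bmeasfun g x) \<Longrightarrow> f = g"
  by transfer auto

instantiation bmeasfun :: (topological_space, real_normed_vector) real_vector
begin

lift_definition zero_bmeasfun :: "('a, 'b) bmeasfun" is "\<lambda>_. 0"
  by (rule bmeasfun_const)

lift_definition plus_bmeasfun :: "('a, 'b) bmeasfun \<Rightarrow> ('a, 'b) bmeasfun \<Rightarrow> ('a, 'b) bmeasfun"
  is "\<lambda>f g x. f x + g x"
  by (rule bmeasfun_plus)

lift_definition scaleR_bmeasfun :: "real \<Rightarrow> ('a, 'b) bmeasfun \<Rightarrow> ('a, 'b) bmeasfun"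
  is "\<lambda>r f x. r *\<^sub>R f x"
  by (rule bmeasfun_scaleR)

lift_definition uminus_bmeasfun :: "('a, 'b) bmeasfun \<Rightarrow> ('a, 'b) bmeasfun" is "\<lambda>f x. - f x"
  using bmeasfun_scaleR[of _ "-1"] by simp

lift_definition minus_bmeasfun :: "('a, 'b) bmeasfun \<Rightarrow> ('a, 'b) bmeasfun \<Rightarrow> ('a, 'b) bmeasfun"
  is "\<lambda>f g x. f x - g x"
  using bmeasfun_plus bmeasfun_scaleR[of _ "-1"] by fastforce

lemmas [simp] =
  zero_bmeasfun.rep_eq plus_bmeasfun.rep_eq scaleR_bmeasfun.rep_eq
  uminus_bmeasfun.rep_eq minus_bmeasfun.rep_eq

instance
  by standard (auto intro!: bmeasfun_eqI simp: algebra_simps)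

end

instantiation bmeasfun :: (topological_space, real_normed_vector) real_normed_vector
begin

definition norm_bmeasfun :: "('a, 'b) bmeasfun \<Rightarrow> real" where
  "norm_bmeasfun f = (SUP x. norm (apply_bmeasfun f x))"

definition dist_bmeasfun :: "('a, 'b) bmeasfun \<Rightarrow> ('a, 'b) bmeasfun \<Rightarrow> real" where
  "dist_bmeasfun f g = norm (f - g)"

definition sgn_bmeasfun :: "('a, 'b) bmeasfun \<Rightarrow> ('a, 'b) bmeasfun" where
  "sgn_bmeasfun f = f /\<^sub>R norm f"

definition uniformity_bmeasfun :: "(('a, 'b) bmeasfun \<times> ('a, 'b) bmeasfun) filter" where
  "uniformity_bmeasfun = (INF e\<in>{0 <..}. principal {(x, y). dist x y < e})"

definition open_bmeasfun :: "('a, 'b) bmeasfun set \<Rightarrow> bool" where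
  "open_bmeasfun S = (\<forall>x\<in>S. \<forall>\<^sub>F (x', y) in uniformity. x' = x \<longrightarrow> y \<in> S)"

lemma norm_apply_bmeasfun_le: "norm (apply_bmeasfun f x) \<le> norm f"
proof -
  have "bounded (range (apply_bmeasfun f))"
    using apply_bmeasfun[of f] by (auto simp: bmeasfun_def)
  then have "bdd_above (range (\<lambda>x. norm (apply_bmeasfun f x)))"
    by (auto simp: bdd_above_norm[symmetric] image_image bounded_iff bdd_above_def)
  then show ?thesis
    unfolding norm_bmeasfun_def by (rule cSUP_upper2) auto
qed

lemma norm_bmeasfun_le: "(\<And>x. norm (apply_bmeasfun f x) \<le> b) \<Longrightarrow> norm f \<le> b"
  unfolding norm_bmeasfun_def by (rule cSUP_least) auto

instance
proof
  fix r :: real and f g :: "('a, 'b) bmeasfun"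
  show "norm f = 0 \<longleftrightarrow> f = 0"
  proof
    assume "norm f = 0"
    then have "norm (apply_bmeasfun f x) \<le> 0" for x
      using norm_apply_bmeasfun_le[of f x] by simp
    then show "f = 0"
      by (auto intro!: bmeasfun_eqI)
  qed (simp add: norm_bmeasfun_def)
  show "norm (f + g) \<le> norm f + norm g"
    by (rule norm_bmeasfun_le) (simp add: norm_triangle_mono norm_apply_bmeasfun_le)
  have le: "norm (s *\<^sub>R h) \<le> \<bar>s\<bar> * norm h" for s :: real and h :: "('a, 'b) bmeasfun"
    by (rule norm_bmeasfun_le) (simp add: mult_left_mono norm_apply_bmeasfun_le)
  show "norm (r *\<^sub>R f) = \<bar>r\<bar> * norm f"
  proof (cases "r = 0")
    case True
    then show ?thesis by (simp add: norm_bmeasfun_def)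
  next
    case False
    then have "norm f \<le> \<bar>inverse r\<bar> * norm (r *\<^sub>R f)"
      using le[of "inverse r" "r *\<^sub>R f"] by simp
    then have "\<bar>r\<bar> * norm f \<le> norm (r *\<^sub>R f)"
      using False by (simp add: field_simps abs_inverse)
    with le[of r f] show ?thesis by simp
  qed
qed (simp_all add: dist_bmeasfun_def sgn_bmeasfun_def uniformity_bmeasfun_def open_bmeasfun_def)

end


section \<open>Vector measures and integration\<close>

definition borel_partitions :: "'o::topological_space set \<Rightarrow> 'o set set set" where
  "borel_partitions A = {P. finite P \<and> P \<subseteq> sets borel \<and> partition_on A P}"

definition variation :: "('o::topological_space set \<Rightarrow> 'z::real_normed_vector) \<Rightarrow> 'o set \<Rightarrow> ennreal"
  where "variation \<mu> A = (SUP P\<in>borel_partitions A. \<Sum>B\<in>P. ennreal (norm (\<mu> B)))"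

definition variation_measure ::
  "('o::topological_space set \<Rightarrow> 'z::real_normed_vector) \<Rightarrow> 'o measure" where
  "variation_measure \<mu> = measure_of UNIV (sets borel) (variation \<mu>)"

definition semivariation ::
  "('o::topological_space set \<Rightarrow> ('x::real_normed_vector \<Rightarrow>\<^sub>L 'z::real_normed_vector)) \<Rightarrow>
    'o set \<Rightarrow> ennreal" where
  "semivariation m A =
    (SUP (P, x) \<in> borel_partitions A \<times> {x. \<forall>B. norm (x B) \<le> 1}.
      ennreal (norm (\<Sum>B\<in>P. blinfun_apply (m B) (x B))))"

definition strongly_bounded ::
  "('o::topological_space set \<Rightarrow> ('x::real_normed_vector \<Rightarrow>\<^sub>L 'z::real_normed_vector)) \<Rightarrow> bool"
  where
  "strongly_bounded m \<longleftrightarrow>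
    (\<forall>A::nat \<Rightarrow> 'o set. range A \<subseteq> sets borel \<and> disjoint_family A \<longrightarrow>
      (\<lambda>n. semivariation m (A n)) \<longlonglongrightarrow> 0)"

(* Regular countably additive Borel measures of bounded variation. A measure is a total function
   on sets of which only the values on Borel sets matter. *)
definition regular_borel_vector_measure ::
  "('o::topological_space set \<Rightarrow> 'z::real_normed_vector) \<Rightarrow> bool" where
  "regular_borel_vector_measure \<mu> \<longleftrightarrow>
    (\<forall>A::nat \<Rightarrow> 'o set. range A \<subseteq> sets borel \<and> disjoint_family A \<longrightarrow>
      (\<lambda>n. \<mu> (A n)) sums \<mu> (\<Union>n. A n)) \<and>
    variation \<mu> UNIV < \<infinity> \<and>
    (\<forall>A\<in>sets borel. \<forall>e>0. \<exists>K U. compact K \<and> open U \<and> K \<subseteq> A \<and> A \<subseteq> U \<and>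
      variation \<mu> (U - K) < e)"

definition simple_vector_integral ::
  "('o set \<Rightarrow> ('x::real_normed_vector \<Rightarrow>\<^sub>L real)) \<Rightarrow> ('o \<Rightarrow> 'x) \<Rightarrow> real" where
  "simple_vector_integral \<mu> s = (\<Sum>y\<in>range s. blinfun_apply (\<mu> (s -` {y})) y)"

(* Integral of an X-valued function against an X*-valued measure of bounded variation: the
   Bochner-type construction by simple functions converging in L1 of the variation. *)
definition has_vector_integral ::
  "('o::topological_space set \<Rightarrow> ('x::real_normed_vector \<Rightarrow>\<^sub>L real)) \<Rightarrow> ('o \<Rightarrow> 'x) \<Rightarrow> real \<Rightarrow> bool"
  where
  "has_vector_integral \<mu> f I \<longleftrightarrow>
    f \<in> borel_measurable borel \<and>
    (\<exists>s. (\<forall>i::nat. simple_function borel (s i)) \<and>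
      (\<lambda>i. \<integral>\<^sup>+ x. ennreal (norm (f x - s i x)) \<partial>variation_measure \<mu>) \<longlonglongrightarrow> 0 \<and>
      (\<lambda>i. simple_vector_integral \<mu> (s i)) \<longlonglongrightarrow> I)"


section \<open>Representing measures\<close>

definition canonical_embedding ::
  "'y::real_normed_vector \<Rightarrow> (('y \<Rightarrow>\<^sub>L real) \<Rightarrow>\<^sub>L real)" where
  "canonical_embedding y = blinfun.prod_left y"

lemma canonical_embedding_apply [simp]:
  "blinfun_apply (canonical_embedding y) \<phi> = blinfun_apply \<phi> y"
  by (simp add: canonical_embedding_def)

(* For m with values in L(X, Y** ) and \<phi> in Y*, the X*-valued measure A |-> (x |-> (m(A) x)(\<phi>)). *)
definition slice_measure ::
  "('o set \<Rightarrow> ('x::real_normed_vector \<Rightarrow>\<^sub>L (('y::real_normed_vector \<Rightarrow>\<^sub>L real) \<Rightarrow>\<^sub>L real))) \<Rightarrow>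
    ('y \<Rightarrow>\<^sub>L real) \<Rightarrow> 'o set \<Rightarrow> ('x \<Rightarrow>\<^sub>L real)" where
  "slice_measure m \<phi> A = blinfun.prod_left \<phi> o\<^sub>L m A"

lemma slice_measure_apply [simp]:
  "blinfun_apply (slice_measure m \<phi> A) x = blinfun_apply (blinfun_apply (m A) x) \<phi>"
  by (simp add: slice_measure_def)

(* F in Y** is the integral of f with respect to m. If m represents T, then slice_measure m \<phi> is
   the regular measure of the functional T*\<phi> on C(\<Omega>,X); hence F \<phi> is the value at T*\<phi> of f, seen
   as an element of C(\<Omega>,X)**, and F = T**f. *)
definition has_operator_integral ::
  "('o::topological_space set \<Rightarrow>
      ('x::real_normed_vector \<Rightarrow>\<^sub>L (('y::real_normed_vector \<Rightarrow>\<^sub>L real) \<Rightarrow>\<^sub>L real))) \<Rightarrow>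
    ('o \<Rightarrow> 'x) \<Rightarrow> (('y \<Rightarrow>\<^sub>L real) \<Rightarrow>\<^sub>L real) \<Rightarrow> bool" where
  "has_operator_integral m f F \<longleftrightarrow>
    (\<forall>\<phi>. has_vector_integral (slice_measure m \<phi>) f (blinfun_apply F \<phi>))"

(* For compact \<Omega>, the type of bounded continuous functions is C(\<Omega>,X). The regularity of the
   slices makes the representing measure unique. *)
definition representing_measure ::
  "('o::topological_space set \<Rightarrow>
      ('x::real_normed_vector \<Rightarrow>\<^sub>L (('y::real_normed_vector \<Rightarrow>\<^sub>L real) \<Rightarrow>\<^sub>L real))) \<Rightarrow>
    (('o \<Rightarrow>\<^sub>C 'x) \<Rightarrow>\<^sub>L 'y) \<Rightarrow> bool" where
  "representing_measure m T \<longleftrightarrow>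
    semivariation m UNIV < \<infinity> \<and>
    (\<forall>\<phi>. regular_borel_vector_measure (slice_measure m \<phi>)) \<and>
    (\<forall>f. has_operator_integral m (apply_bcontfun f) (canonical_embedding (blinfun_apply T f)))"

definition bounded_borel_extension ::
  "('o::topological_space set \<Rightarrow>
      ('x::real_normed_vector \<Rightarrow>\<^sub>L (('y::real_normed_vector \<Rightarrow>\<^sub>L real) \<Rightarrow>\<^sub>L real))) \<Rightarrow>
    (('o, 'x) bmeasfun \<Rightarrow>\<^sub>L 'y) \<Rightarrow> bool" where
  "bounded_borel_extension m T' \<longleftrightarrow>
    (\<forall>f. has_operator_integral m (apply_bmeasfun f) (canonical_embedding (blinfun_apply T' f)))"


section \<open>Dunford-Pettis p-convergent operators\<close>

lift_definition adjoint_op ::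
  "('a::real_normed_vector \<Rightarrow>\<^sub>L 'b::real_normed_vector) \<Rightarrow> (('b \<Rightarrow>\<^sub>L real) \<Rightarrow>\<^sub>L ('a \<Rightarrow>\<^sub>L real))"
  is "\<lambda>T \<phi>. \<phi> o\<^sub>L T"
  by (rule bounded_bilinear.bounded_linear_left[OF bounded_bilinear_blinfun_compose])

definition weakly_p_summable :: "real \<Rightarrow> (nat \<Rightarrow> 'a::real_normed_vector) \<Rightarrow> bool" where
  "weakly_p_summable p x \<longleftrightarrow>
    (\<forall>\<phi>::'a \<Rightarrow>\<^sub>L real. summable (\<lambda>n. \<bar>blinfun_apply \<phi> (x n)\<bar> powr p))"

definition weakly_null :: "(nat \<Rightarrow> 'a::real_normed_vector) \<Rightarrow> bool" where
  "weakly_null x \<longleftrightarrow> (\<forall>\<phi>::'a \<Rightarrow>\<^sub>L real. (\<lambda>n. blinfun_apply \<phi> (x n)) \<longlonglongrightarrow> 0)"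

definition Dunford_Pettis_set :: "'a::real_normed_vector set \<Rightarrow> bool" where
  "Dunford_Pettis_set K \<longleftrightarrow>
    bounded K \<and>
    (\<forall>\<phi>::nat \<Rightarrow> 'a \<Rightarrow>\<^sub>L real. weakly_null \<phi> \<longrightarrow>
      uniform_limit K (\<lambda>n. blinfun_apply (\<phi> n)) (\<lambda>_. 0) sequentially)"

definition Dunford_Pettis_p_convergent ::
  "real \<Rightarrow> ('a::real_normed_vector \<Rightarrow>\<^sub>L 'b::real_normed_vector) \<Rightarrow> bool" where
  "Dunford_Pettis_p_convergent p T \<longleftrightarrow>
    (\<forall>x. weakly_p_summable p x \<and> Dunford_Pettis_set (range x) \<longrightarrow>
      (\<lambda>n. blinfun_apply T (x n)) \<longlonglongrightarrow> 0)"

end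

theory Submission
  imports Defs
begin

text \<open>
  The adjoints of \<open>T\<close> and of its extension \<open>T_hat\<close> have the same domain, the dual of \<open>Y\<close>, and the
  whole theorem rests on the identity \<open>\<parallel>\<phi> \<circ> T\<parallel> = \<parallel>\<phi> \<circ> T_hat\<parallel>\<close> for every functional \<open>\<phi>\<close> on \<open>Y\<close>:
  then the two images of any sequence of functionals have the same norms, so one image is norm null
  exactly when the other is.

  For the identity fix \<open>\<phi>\<close> and let \<open>\<mu>\<close> be the slice of the representing measure at \<open>\<phi>\<close>, a regular
  measure of bounded variation against which both \<open>\<phi> \<circ> T\<close> and \<open>\<phi> \<circ> T_hat\<close> integrate.
  Integrals against \<open>\<mu>\<close> differ by at most the distance of the integrands in \<open>L\<^sup>1\<close> of the variation
  of \<open>\<mu>\<close> (\<open>has_vector_integral_dist_le\<close>). In particular they are unique, so \<open>T_hat\<close> extends \<open>T\<close>;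
  since \<open>C(\<Omega>, X)\<close> sits isometrically in \<open>B(\<Omega>, X)\<close>, this gives \<open>\<parallel>\<phi> \<circ> T\<parallel> \<le> \<parallel>\<phi> \<circ> T_hat\<parallel>\<close>. For the
  converse, every \<open>f\<close> in \<open>B(\<Omega>, X)\<close> is an \<open>L\<^sup>1\<close> limit of continuous functions whose norm does not
  exceed that of \<open>f\<close> (\<open>bmeasfun_L1_approx_bcontfun\<close>): approximate by simple functions, smooth
  their level sets by Urysohn functions, using regularity, and push the result back into the ball of
  radius \<open>\<parallel>f\<parallel>\<close> by the radial retraction, which is Lipschitz in every normed space. Hence
  \<open>\<phi> (T_hat f)\<close> is a limit of numbers bounded by \<open>\<parallel>\<phi> \<circ> T\<parallel> * \<parallel>f\<parallel>\<close>.
\<close>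

section \<open>The variation as a measure\<close>

text \<open>
  The countably additive part of \<^const>\<open>regular_borel_vector_measure\<close>: the variation and the
  integral are developed at this level, and regularity comes in with the continuous approximants.
\<close>

definition borel_vector_measure ::
  "('o::topological_space set \<Rightarrow> 'z::real_normed_vector) \<Rightarrow> bool" where
  "borel_vector_measure \<mu> \<longleftrightarrow>
    (\<forall>A::nat \<Rightarrow> 'o set. range A \<subseteq> sets borel \<and> disjoint_family A \<longrightarrow>
      (\<lambda>n. \<mu> (A n)) sums \<mu> (\<Union>n. A n))"

lemma regular_borel_vector_measure_imp:
  "regular_borel_vector_measure \<mu> \<Longrightarrow> borel_vector_measure \<mu>"
  by (auto simp: regular_borel_vector_measure_def borel_vector_measure_def)

lemma borel_vector_measure_sums:
  assumes "borel_vector_measure \<mu>" "\<And>n::nat. A n \<in> sets borel" "disjoint_family A"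
  shows "(\<lambda>n. \<mu> (A n)) sums \<mu> (\<Union>n. A n)"
  using assms by (auto simp: borel_vector_measure_def)

lemma borel_vector_measure_empty:
  assumes "borel_vector_measure \<mu>"
  shows "\<mu> {} = 0"
proof -
  have "(\<lambda>n::nat. \<mu> {}) sums \<mu> {}"
    using borel_vector_measure_sums[OF assms, of "\<lambda>_. {}"] by (simp add: disjoint_family_on_def)
  then show ?thesis
    using sums_summable summable_const_iff by blast
qed

lemma borel_vector_measure_Un:
  assumes \<mu>: "borel_vector_measure \<mu>" and AB: "A \<in> sets borel" "B \<in> sets borel" "A \<inter> B = {}"
  shows "\<mu> (A \<union> B) = \<mu> A + \<mu> B"
proof -
  have "binaryset A B n \<in> sets borel" for n
    using AB by (simp add: binaryset_def)
  moreover have "disjoint_family (binaryset A B)"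
    using AB(3) by (auto simp: disjoint_family_on_def binaryset_def)
  ultimately have "(\<lambda>n. \<mu> (binaryset A B n)) sums \<mu> (A \<union> B)"
    using borel_vector_measure_sums[OF \<mu>, of "binaryset A B"] by (simp add: UN_binaryset_eq)
  moreover have "(\<lambda>n. \<mu> (binaryset A B n)) sums (\<mu> A + \<mu> B)"
    using borel_vector_measure_empty[OF \<mu>] by (intro binaryset_sums)
  ultimately show ?thesis
    using sums_unique2 by blast
qed

lemma borel_vector_measure_UN:
  assumes \<mu>: "borel_vector_measure \<mu>" and I: "finite I"
    and C: "\<And>i. i \<in> I \<Longrightarrow> C i \<in> sets borel" "disjoint_family_on C I"
  shows "\<mu> (\<Union>i\<in>I. C i) = (\<Sum>i\<in>I. \<mu> (C i))"
  using I C
proof (induction I)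
  case empty
  then show ?case using borel_vector_measure_empty[OF \<mu>] by simp
next
  case (insert i I)
  have "C i \<inter> (\<Union>j\<in>I. C j) = {}"
    using insert by (auto simp: disjoint_family_on_def)
  moreover have "(\<Union>j\<in>I. C j) \<in> sets borel"
    using insert by (intro sets.finite_UN) auto
  moreover have "disjoint_family_on C I"
    using insert by (auto simp: disjoint_family_on_def)
  ultimately show ?case
    using insert borel_vector_measure_Un[OF \<mu>, of "C i" "\<Union>j\<in>I. C j"] by simp
qed

text \<open>
  Families that may repeat the empty set and need not cover \<open>A\<close> are what arises in practice,
  whereas the supremum defining the variation ranges over partitions into nonempty sets. Empty
  members contribute nothing, and adding the uncovered rest of \<open>A\<close> only increases the sum.
\<close>

lemma sum_norm_le_variation:
  assumes \<mu>: "\<mu> {} = 0" and I: "finite I"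
    and C: "\<And>i. i \<in> I \<Longrightarrow> C i \<in> sets borel" "disjoint_family_on C I" "\<And>i. i \<in> I \<Longrightarrow> C i \<subseteq> A"
    and A: "A \<in> sets borel"
  shows "(\<Sum>i\<in>I. ennreal (norm (\<mu> (C i)))) \<le> variation \<mu> A"
proof -
  define J where "J = {i\<in>I. C i \<noteq> {}}"
  define R where "R = A - (\<Union>i\<in>I. C i)"
  define P where "P = (C ` J \<union> {R}) - {{}}"
  have "inj_on C J"
    using C(2) by (auto simp: inj_on_def J_def disjoint_family_on_def)
  have "P \<in> borel_partitions A"
  proof -
    have "(\<Union>i\<in>I. C i) \<in> sets borel"
      using C I by (intro sets.finite_UN) auto
    then have "R \<in> sets borel"
      using A by (auto simp: R_def)
    then have "P \<subseteq> sets borel"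
      using C by (auto simp: P_def J_def)
    moreover have "partition_on A P"
    proof (rule partition_onI)
      show "\<Union>P = A"
      proof -
        have "\<Union>P = (\<Union>i\<in>J. C i) \<union> R"
          by (auto simp: P_def)
        also have "(\<Union>i\<in>J. C i) = (\<Union>i\<in>I. C i)"
          by (auto simp: J_def)
        also have "\<dots> \<union> R = A"
          using C(3) by (auto simp: R_def)
        finally show ?thesis .
      qed
      have CC: "C i \<inter> C j = {}" if "i \<in> J" "j \<in> J" "C i \<noteq> C j" for i j
        using disjoint_family_onD[OF C(2), of i j] that by (auto simp: J_def)
      have CR: "C i \<inter> R = {}" if "i \<in> J" for i
        using that by (auto simp: J_def R_def)
      show "disjnt p q" if pq: "p \<in> P" "q \<in> P" "p \<noteq> q" for p q
      proof -
        have "p = R \<or> (\<exists>i\<in>J. p = C i)" "q = R \<or> (\<exists>i\<in>J. q = C i)"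
          using pq(1,2) by (auto simp: P_def)
        then show ?thesis
          using pq(3) CC CR unfolding disjnt_def by (metis Int_commute)
      qed
    qed (auto simp: P_def)
    ultimately show ?thesis
      using I by (auto simp: borel_partitions_def P_def J_def)
  qed
  have "(\<Sum>i\<in>I. ennreal (norm (\<mu> (C i)))) = (\<Sum>i\<in>J. ennreal (norm (\<mu> (C i))))"
    using I \<mu> by (intro sum.mono_neutral_right) (auto simp: J_def)
  also have "\<dots> = (\<Sum>B\<in>C ` J. ennreal (norm (\<mu> B)))"
    using \<open>inj_on C J\<close> by (simp add: sum.reindex)
  also have "\<dots> \<le> (\<Sum>B\<in>P. ennreal (norm (\<mu> B)))"
    using I by (intro sum_mono2) (auto simp: P_def J_def)
  also have "\<dots> \<le> variation \<mu> A"
    unfolding variation_def using \<open>P \<in> borel_partitions A\<close> by (rule SUP_upper)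
  finally show ?thesis .
qed

lemma borel_partitions_nonempty:
  assumes "A \<in> sets borel"
  shows "borel_partitions A \<noteq> {}"
proof -
  have "{A} - {{}} \<in> borel_partitions A"
    using assms by (auto simp: borel_partitions_def partition_on_def disjoint_def)
  then show ?thesis by blast
qed

lemma borel_partitionsD:
  assumes "P \<in> borel_partitions A"
  shows "finite P" "\<And>B. B \<in> P \<Longrightarrow> B \<in> sets borel" "disjoint_family_on id P" "\<Union>P = A" "{} \<notin> P"
proof -
  have P: "finite P" "P \<subseteq> sets borel" "partition_on A P"
    using assms by (simp_all add: borel_partitions_def)
  show "finite P" "\<And>B. B \<in> P \<Longrightarrow> B \<in> sets borel"
    using P(1,2) by blast+
  show "\<Union>P = A" "{} \<notin> P"
    using P(3) by (simp_all add: partition_on_def)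
  have "disjoint P"
    using P(3) by (simp add: partition_on_def)
  then show "disjoint_family_on id P"
    by (simp add: disjoint_def disjoint_family_on_def)
qed

lemma variation_empty: "variation \<mu> {} = 0"
proof -
  have "borel_partitions ({} :: 'a::topological_space set) = {{}}"
    by (auto simp: borel_partitions_def partition_on_def)
  then show ?thesis
    by (simp add: variation_def)
qed

lemma norm_le_variation:
  assumes "\<mu> {} = 0" "A \<in> sets borel"
  shows "ennreal (norm (\<mu> A)) \<le> variation \<mu> A"
  using sum_norm_le_variation[of \<mu> "{()}" "\<lambda>_. A" A] assms by (simp add: disjoint_family_on_def)

lemma variation_superadditive:
  assumes \<mu>: "\<mu> {} = 0" and AB: "A \<in> sets borel" "B \<in> sets borel" "A \<inter> B = {}"
  shows "variation \<mu> A + variation \<mu> B \<le> variation \<mu> (A \<union> B)"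
proof -
  have *: "(\<Sum>C\<in>P. ennreal (norm (\<mu> C))) + (\<Sum>C\<in>Q. ennreal (norm (\<mu> C))) \<le> variation \<mu> (A \<union> B)"
    if "P \<in> borel_partitions A" "Q \<in> borel_partitions B" for P Q
  proof -
    note P = borel_partitionsD[OF that(1)] and Q = borel_partitionsD[OF that(2)]
    have sub: "C \<subseteq> A" if "C \<in> P" for C
      using Union_upper[OF that] P(4) by simp
    have sub': "C \<subseteq> B" if "C \<in> Q" for C
      using Union_upper[OF that] Q(4) by simp
    have cross: "C \<inter> D = {}" if "C \<in> P" "D \<in> Q" for C D
      using sub[OF that(1)] sub'[OF that(2)] AB(3) by blast
    then have "P \<inter> Q = {}"
      using P(5) by (metis Int_iff inf.idem equals0I)
    then have "(\<Sum>C\<in>P. ennreal (norm (\<mu> C))) + (\<Sum>C\<in>Q. ennreal (norm (\<mu> C)))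
        = (\<Sum>C\<in>P \<union> Q. ennreal (norm (\<mu> (id C))))"
      using P(1) Q(1) by (simp add: sum.union_disjoint del: sum_ennreal)
    also have "\<dots> \<le> variation \<mu> (A \<union> B)"
    proof (rule sum_norm_le_variation)
      show "disjoint_family_on id (P \<union> Q)"
        unfolding disjoint_family_on_def
      proof (intro ballI impI)
        fix C D assume CD: "C \<in> P \<union> Q" "D \<in> P \<union> Q" "C \<noteq> D"
        show "id C \<inter> id D = {}"
          using CD disjoint_family_onD[OF P(3), of C D] disjoint_family_onD[OF Q(3), of C D]
            cross[of C D] cross[of D C] by (elim UnE) (simp_all add: Int_commute)
      qed
    qed (use P Q AB \<mu> sub sub' in auto)
    finally show ?thesis .
  qed
  have "variation \<mu> A + variation \<mu> B
      = (SUP P\<in>borel_partitions A. (\<Sum>C\<in>P. ennreal (norm (\<mu> C))) + variation \<mu> B)"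
    unfolding variation_def[of \<mu> A] using borel_partitions_nonempty[OF AB(1)]
    by (simp add: ennreal_SUP_add_left)
  also have "\<dots> \<le> variation \<mu> (A \<union> B)"
  proof (rule SUP_least)
    fix P assume P: "P \<in> borel_partitions A"
    have "(\<Sum>C\<in>P. ennreal (norm (\<mu> C))) + variation \<mu> B
        = (SUP Q\<in>borel_partitions B. (\<Sum>C\<in>P. ennreal (norm (\<mu> C))) + (\<Sum>C\<in>Q. ennreal (norm (\<mu> C))))"
      unfolding variation_def[of \<mu> B] using borel_partitions_nonempty[OF AB(2)]
      by (simp add: ennreal_SUP_add_right)
    also have "\<dots> \<le> variation \<mu> (A \<union> B)"
      using *[OF P] by (rule SUP_least)
    finally show "(\<Sum>C\<in>P. ennreal (norm (\<mu> C))) + variation \<mu> B \<le> variation \<mu> (A \<union> B)" .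
  qed
  finally show ?thesis .
qed

lemma variation_mono:
  assumes "\<mu> {} = 0" "A \<in> sets borel" "B \<in> sets borel" "A \<subseteq> B"
  shows "variation \<mu> A \<le> variation \<mu> B"
proof -
  have "variation \<mu> A \<le> variation \<mu> A + variation \<mu> (B - A)"
    by simp
  also have "\<dots> \<le> variation \<mu> (A \<union> (B - A))"
    using assms by (intro variation_superadditive) auto
  also have "A \<union> (B - A) = B"
    using assms by auto
  finally show ?thesis .
qed

lemma sum_variation_le:
  fixes A :: "nat \<Rightarrow> 'o::topological_space set"
  assumes \<mu>: "\<mu> {} = 0" and A: "\<And>n. A n \<in> sets borel" "disjoint_family A"
  shows "(\<Sum>n<N. variation \<mu> (A n)) \<le> variation \<mu> (\<Union>n<N. A n)"
proof (induction N)
  case 0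
  then show ?case by simp
next
  case (Suc N)
  have "A n \<inter> A N = {}" if "n < N" for n
    using disjoint_family_onD[OF A(2), of n N] that by simp
  then have "(\<Union>n<N. A n) \<inter> A N = {}"
    by blast
  then have "variation \<mu> (\<Union>n<N. A n) + variation \<mu> (A N) \<le> variation \<mu> ((\<Union>n<N. A n) \<union> A N)"
    using \<mu> A by (intro variation_superadditive) auto
  moreover have "(\<Union>n<Suc N. A n) = (\<Union>n<N. A n) \<union> A N"
    by (auto simp: less_Suc_eq)
  ultimately show ?case
    using Suc by (simp add: order_trans[OF add_right_mono])
qed

lemma ennreal_norm_sums_le:
  fixes a :: "nat \<Rightarrow> 'z::real_normed_vector"
  assumes "a sums l"
  shows "ennreal (norm l) \<le> (\<Sum>n. ennreal (norm (a n)))"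
proof (rule LIMSEQ_le_const2)
  show "(\<lambda>N. ennreal (norm (\<Sum>n<N. a n))) \<longlonglongrightarrow> ennreal (norm l)"
    using assms by (intro tendsto_ennrealI tendsto_norm) (simp add: sums_def)
  have "ennreal (norm (\<Sum>n<N. a n)) \<le> (\<Sum>n. ennreal (norm (a n)))" for N
  proof -
    have "ennreal (norm (\<Sum>n<N. a n)) \<le> ennreal (\<Sum>n<N. norm (a n))"
      by (intro ennreal_leI norm_sum)
    also have "\<dots> = (\<Sum>n<N. ennreal (norm (a n)))"
      by simp
    also have "\<dots> \<le> (\<Sum>n. ennreal (norm (a n)))"
      by (intro sum_le_suminf) auto
    finally show ?thesis .
  qed
  then show "\<exists>N. \<forall>n\<ge>N. ennreal (norm (\<Sum>n<n. a n)) \<le> (\<Sum>n. ennreal (norm (a n)))"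
    by blast
qed

text \<open>
  Finite superadditivity gives one inequality. For the other, cutting each member \<open>B\<close> of a partition
  of the union by the sets \<open>A n\<close> bounds \<open>\<parallel>\<mu> B\<parallel>\<close> by \<open>\<Sum>n. \<parallel>\<mu> (B \<inter> A n)\<parallel>\<close>, and for fixed \<open>n\<close> the pieces
  \<open>B \<inter> A n\<close> are disjoint subsets of \<open>A n\<close>.
\<close>

lemma variation_countably_additive:
  assumes \<mu>: "borel_vector_measure \<mu>"
  shows "countably_additive (sets borel) (variation \<mu>)"
proof (rule countably_additiveI)
  fix A :: "nat \<Rightarrow> 'a set"
  assume rA: "range A \<subseteq> sets borel" and disj: "disjoint_family A"
    and UA: "(\<Union>n. A n) \<in> sets borel"
  have A: "\<And>n. A n \<in> sets borel"
    using rA by auto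
  note \<mu>0 = borel_vector_measure_empty[OF \<mu>]
  show "(\<Sum>n. variation \<mu> (A n)) = variation \<mu> (\<Union>n. A n)"
  proof (rule antisym)
    have "(\<Sum>n<N. variation \<mu> (A n)) \<le> variation \<mu> (\<Union>n. A n)" for N
    proof -
      have "variation \<mu> (\<Union>n<N. A n) \<le> variation \<mu> (\<Union>n. A n)"
        using A UA \<mu>0 by (intro variation_mono) auto
      with sum_variation_le[of \<mu> A N, OF \<mu>0 A disj] show ?thesis
        by (rule order_trans)
    qed
    then show "(\<Sum>n. variation \<mu> (A n)) \<le> variation \<mu> (\<Union>n. A n)"
      by (intro suminf_le_const) auto
    show "variation \<mu> (\<Union>n. A n) \<le> (\<Sum>n. variation \<mu> (A n))"
      unfolding variation_def[of \<mu> "\<Union>n. A n"]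
    proof (rule SUP_least)
      fix P assume "P \<in> borel_partitions (\<Union>n. A n)"
      note P = borel_partitionsD[OF this]
      have "(\<Sum>B\<in>P. ennreal (norm (\<mu> B))) \<le> (\<Sum>B\<in>P. \<Sum>n. ennreal (norm (\<mu> (B \<inter> A n))))"
      proof (rule sum_mono)
        fix B assume B: "B \<in> P"
        have "(\<Union>n. B \<inter> A n) = B"
          using B P(4) by blast
        moreover have "disjoint_family (\<lambda>n. B \<inter> A n)"
          using disj by (auto simp: disjoint_family_on_def)
        ultimately have "(\<lambda>n. \<mu> (B \<inter> A n)) sums \<mu> B"
          using borel_vector_measure_sums[OF \<mu>, of "\<lambda>n. B \<inter> A n"] A P(2)[OF B] by auto
        then show "ennreal (norm (\<mu> B)) \<le> (\<Sum>n. ennreal (norm (\<mu> (B \<inter> A n))))"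
          by (rule ennreal_norm_sums_le)
      qed
      also have "\<dots> = (\<Sum>n. \<Sum>B\<in>P. ennreal (norm (\<mu> (B \<inter> A n))))"
        by (rule suminf_sum[symmetric]) auto
      also have "\<dots> \<le> (\<Sum>n. variation \<mu> (A n))"
      proof (rule suminf_le)
        fix n
        show "(\<Sum>B\<in>P. ennreal (norm (\<mu> (B \<inter> A n)))) \<le> variation \<mu> (A n)"
        proof (rule sum_norm_le_variation)
          show "disjoint_family_on (\<lambda>B. B \<inter> A n) P"
            using P(3) by (auto simp: disjoint_family_on_def)
        qed (use P A \<mu>0 in auto)
      qed auto
      finally show "(\<Sum>B\<in>P. ennreal (norm (\<mu> B))) \<le> (\<Sum>n. variation \<mu> (A n))" .
    qed
  qed
qed

lemma sets_variation_measure [simp, measurable_cong]: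
  "sets (variation_measure \<mu>) = sets borel"
  unfolding variation_measure_def
  using sets.sigma_sets_eq[of borel] by (simp add: sets_measure_of)

lemma space_variation_measure [simp]: "space (variation_measure \<mu>) = UNIV"
  by (simp add: variation_measure_def space_measure_of_conv)

lemma emeasure_variation_measure:
  assumes \<mu>: "borel_vector_measure \<mu>" and A: "A \<in> sets borel"
  shows "emeasure (variation_measure \<mu>) A = variation \<mu> A"
proof (rule emeasure_measure_of[OF variation_measure_def])
  show "positive (sets (variation_measure \<mu>)) (variation \<mu>)"
    by (simp add: positive_def variation_empty)
  show "countably_additive (sets (variation_measure \<mu>)) (variation \<mu>)"
    using variation_countably_additive[OF \<mu>] by simp
qed (use A in auto)


section \<open>Integrals against a vector measure\<close>

lemma simple_function_borel_vimage:
  assumes "simple_function borel s"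
  shows "s -` {y} \<in> sets borel"
proof (cases "y \<in> range s")
  case True
  then show ?thesis
    using assms by (auto simp: simple_function_def)
next
  case False
  then have "s -` {y} = {}" by auto
  then show ?thesis by simp
qed

lemma simple_function_borel_finite_range: "simple_function borel s \<Longrightarrow> finite (range s)"
  by (simp add: simple_function_def)

lemma simple_vector_integral_refine:
  assumes \<mu>: "borel_vector_measure \<mu>" and s: "simple_function borel s" and t: "simple_function borel t"
  shows "simple_vector_integral \<mu> s =
    (\<Sum>y\<in>range s. \<Sum>z\<in>range t. blinfun_apply (\<mu> (s -` {y} \<inter> t -` {z})) y)"
  unfolding simple_vector_integral_def
proof (rule sum.cong)
  fix y
  have "\<mu> (s -` {y}) = \<mu> (\<Union>z\<in>range t. s -` {y} \<inter> t -` {z})"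
    by (rule arg_cong[of _ _ \<mu>]) auto
  also have "\<dots> = (\<Sum>z\<in>range t. \<mu> (s -` {y} \<inter> t -` {z}))"
    using s t
    by (intro borel_vector_measure_UN[OF \<mu>])
      (auto simp: simple_function_borel_finite_range disjoint_family_on_def
        intro!: sets.Int simple_function_borel_vimage)
  finally show "blinfun_apply (\<mu> (s -` {y})) y
      = (\<Sum>z\<in>range t. blinfun_apply (\<mu> (s -` {y} \<inter> t -` {z})) y)"
    by (simp add: blinfun.sum_left)
qed simp

text \<open>
  On each set of the common refinement of the level sets of \<open>s\<close> and \<open>t\<close> the difference \<open>s - t\<close> is
  constant, so both sides are finite sums over that refinement; termwise the bound is
  \<open>\<parallel>\<mu> E\<parallel> \<le> variation \<mu> E\<close>.
\<close>

lemma simple_vector_integral_dist_le: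
  assumes \<mu>: "borel_vector_measure \<mu>" and s: "simple_function borel s" and t: "simple_function borel t"
  shows "ennreal \<bar>simple_vector_integral \<mu> s - simple_vector_integral \<mu> t\<bar>
    \<le> (\<integral>\<^sup>+ x. ennreal (norm (s x - t x)) \<partial>variation_measure \<mu>)"
proof -
  define E where "E = (\<lambda>(y, z). s -` {y} \<inter> t -` {z})"
  define R where "R = range s \<times> range t"
  have fin: "finite R"
    using s t by (simp add: R_def simple_function_borel_finite_range)
  have E: "E q \<in> sets borel" for q
    using s t by (auto simp: E_def split: prod.split intro!: sets.Int simple_function_borel_vimage)
  have S: "simple_vector_integral \<mu> s = (\<Sum>q\<in>R. blinfun_apply (\<mu> (E q)) (fst q))"
    using simple_vector_integral_refine[OF \<mu> s t]
    by (simp add: sum.cartesian_product R_def E_def split_def)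
  have "simple_vector_integral \<mu> t
      = (\<Sum>z\<in>range t. \<Sum>y\<in>range s. blinfun_apply (\<mu> (s -` {y} \<inter> t -` {z})) z)"
    using simple_vector_integral_refine[OF \<mu> t s] by (simp add: Int_commute)
  also have "\<dots> = (\<Sum>q\<in>R. blinfun_apply (\<mu> (E q)) (snd q))"
    by (subst sum.swap) (simp add: sum.cartesian_product R_def E_def split_def)
  finally have D: "simple_vector_integral \<mu> s - simple_vector_integral \<mu> t
      = (\<Sum>q\<in>R. blinfun_apply (\<mu> (E q)) (fst q - snd q))"
    by (simp add: S sum_subtractf blinfun.diff_right)
  have pt: "ennreal (norm (s x - t x))
      = (\<Sum>q\<in>R. ennreal (norm (fst q - snd q)) * indicator (E q) x)" for x
  proof -
    have "(\<Sum>q\<in>R. ennreal (norm (fst q - snd q)) * indicator (E q) x)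
        = (\<Sum>q\<in>{(s x, t x)}. ennreal (norm (fst q - snd q)) * indicator (E q) x)"
      using fin by (intro sum.mono_neutral_right) (auto simp: R_def E_def indicator_def)
    then show ?thesis
      by (simp add: E_def)
  qed
  have "ennreal \<bar>simple_vector_integral \<mu> s - simple_vector_integral \<mu> t\<bar>
      \<le> ennreal (\<Sum>q\<in>R. \<bar>blinfun_apply (\<mu> (E q)) (fst q - snd q)\<bar>)"
    unfolding D by (intro ennreal_leI sum_abs)
  also have "\<dots> \<le> ennreal (\<Sum>q\<in>R. norm (fst q - snd q) * norm (\<mu> (E q)))"
    by (intro ennreal_leI sum_mono) (metis norm_blinfun mult.commute real_norm_def)
  also have "\<dots> = (\<Sum>q\<in>R. ennreal (norm (fst q - snd q)) * ennreal (norm (\<mu> (E q))))"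
    by (simp add: ennreal_mult flip: sum_ennreal)
  also have "\<dots> \<le> (\<Sum>q\<in>R. ennreal (norm (fst q - snd q)) * emeasure (variation_measure \<mu>) (E q))"
    using E norm_le_variation[of \<mu>, OF borel_vector_measure_empty[OF \<mu>]]
    by (intro sum_mono mult_left_mono) (auto simp: emeasure_variation_measure[OF \<mu>])
  also have "\<dots> = (\<integral>\<^sup>+ x. (\<Sum>q\<in>R. ennreal (norm (fst q - snd q)) * indicator (E q) x)
      \<partial>variation_measure \<mu>)"
    using E by (subst nn_integral_sum) (auto simp: nn_integral_cmult_indicator)
  also have "\<dots> = (\<integral>\<^sup>+ x. ennreal (norm (s x - t x)) \<partial>variation_measure \<mu>)"
    using pt by simp
  finally show ?thesis .
qed

lemma simple_function_imp_bmeasfun: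
  assumes "simple_function borel s"
  shows "s \<in> bmeasfun"
proof -
  have "separable_space (top_of_set (range s))"
  proof (rule separable_rangeI[of "range s"])
    show "\<exists>d\<in>range s. dist d (s x) < e" if "e > 0" for x e
      using that by (intro bexI[of _ "s x"]) auto
  qed (use simple_function_borel_finite_range[OF assms] in \<open>rule countable_finite\<close>)
  then show ?thesis
    using assms simple_function_borel_finite_range[OF assms]
    by (auto simp: bmeasfun_def borel_measurable_simple_function finite_imp_bounded)
qed

lemma norm_diff_bmeasfun_measurable:
  assumes "f \<in> bmeasfun" "g \<in> bmeasfun"
  shows "(\<lambda>x. norm (f x - g x)) \<in> borel_measurable borel"
proof -
  have "(\<lambda>x. f x + (-1) *\<^sub>R g x) \<in> bmeasfun"
    using assms by (intro bmeasfun_plus bmeasfun_scaleR)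
  then have "(\<lambda>x. f x - g x) \<in> borel_measurable borel"
    by (simp add: bmeasfun_def)
  then show ?thesis
    by (intro borel_measurable_continuous_on[of norm]) (auto intro: continuous_intros)
qed

text \<open>
  The triangle inequality in \<open>L\<^sup>1\<close> of the variation. The integrands are taken from
  \<^const>\<open>bmeasfun\<close> because differences of Borel functions into a nonseparable space
  need not be Borel.
\<close>

lemma L1_triangle:
  assumes "f \<in> bmeasfun" "g \<in> bmeasfun" "h \<in> bmeasfun"
  shows "(\<integral>\<^sup>+ x. ennreal (norm (f x - h x)) \<partial>variation_measure \<mu>)
    \<le> (\<integral>\<^sup>+ x. ennreal (norm (f x - g x)) \<partial>variation_measure \<mu>)
      + (\<integral>\<^sup>+ x. ennreal (norm (g x - h x)) \<partial>variation_measure \<mu>)"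
proof -
  have [measurable]: "(\<lambda>x. norm (f x - g x)) \<in> borel_measurable borel"
    "(\<lambda>x. norm (g x - h x)) \<in> borel_measurable borel"
    using assms norm_diff_bmeasfun_measurable by blast+
  have "(\<integral>\<^sup>+ x. ennreal (norm (f x - h x)) \<partial>variation_measure \<mu>)
      \<le> (\<integral>\<^sup>+ x. ennreal (norm (f x - g x)) + ennreal (norm (g x - h x)) \<partial>variation_measure \<mu>)"
  proof (rule nn_integral_mono)
    fix x
    have "norm (f x - h x) \<le> norm (f x - g x) + norm (g x - h x)"
      using norm_triangle_ineq[of "f x - g x" "g x - h x"] by simp
    then show "ennreal (norm (f x - h x)) \<le> ennreal (norm (f x - g x)) + ennreal (norm (g x - h x))"
      by (simp add: ennreal_leI flip: ennreal_plus)
  qed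
  also have "\<dots> = (\<integral>\<^sup>+ x. ennreal (norm (f x - g x)) \<partial>variation_measure \<mu>)
      + (\<integral>\<^sup>+ x. ennreal (norm (g x - h x)) \<partial>variation_measure \<mu>)"
    by (intro nn_integral_add) measurable
  finally show ?thesis .
qed

lemma L1_commute:
  fixes f g :: "'o \<Rightarrow> 'x::real_normed_vector"
  shows "(\<integral>\<^sup>+ x. ennreal (norm (f x - g x)) \<partial>M) = (\<integral>\<^sup>+ x. ennreal (norm (g x - f x)) \<partial>M)"
  by (simp add: norm_minus_commute)

text \<open>
  The estimate for simple functions passes to the limit along the two approximating sequences. It
  says at once that the integral does not depend on the approximating sequence and that it is
  continuous in \<open>L\<^sup>1\<close> of the variation.
\<close>

lemma has_vector_integral_dist_le:
  assumes \<mu>: "borel_vector_measure \<mu>" and fg: "f \<in> bmeasfun" "g \<in> bmeasfun"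
    and I: "has_vector_integral \<mu> f I" and J: "has_vector_integral \<mu> g J"
  shows "ennreal \<bar>I - J\<bar> \<le> (\<integral>\<^sup>+ x. ennreal (norm (f x - g x)) \<partial>variation_measure \<mu>)"
proof -
  obtain s where s: "\<And>i::nat. simple_function borel (s i)"
    "(\<lambda>i. \<integral>\<^sup>+ x. ennreal (norm (f x - s i x)) \<partial>variation_measure \<mu>) \<longlonglongrightarrow> 0"
    "(\<lambda>i. simple_vector_integral \<mu> (s i)) \<longlonglongrightarrow> I"
    using I by (auto simp: has_vector_integral_def)
  obtain t where t: "\<And>i::nat. simple_function borel (t i)"
    "(\<lambda>i. \<integral>\<^sup>+ x. ennreal (norm (g x - t i x)) \<partial>variation_measure \<mu>) \<longlonglongrightarrow> 0"
    "(\<lambda>i. simple_vector_integral \<mu> (t i)) \<longlonglongrightarrow> J"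
    using J by (auto simp: has_vector_integral_def)
  let ?d = "\<lambda>f g. \<integral>\<^sup>+ x. ennreal (norm (f x - g x)) \<partial>variation_measure \<mu>"
  have le: "ennreal \<bar>simple_vector_integral \<mu> (s i) - simple_vector_integral \<mu> (t i)\<bar>
      \<le> ?d f (s i) + (?d f g + ?d g (t i))" for i
  proof -
    note sm = simple_function_imp_bmeasfun[OF s(1)] simple_function_imp_bmeasfun[OF t(1)]
    have "ennreal \<bar>simple_vector_integral \<mu> (s i) - simple_vector_integral \<mu> (t i)\<bar> \<le> ?d (s i) (t i)"
      using simple_vector_integral_dist_le[OF \<mu> s(1) t(1)] .
    also have "\<dots> \<le> ?d (s i) f + ?d f (t i)"
      by (rule L1_triangle[OF sm(1) fg(1) sm(2)])
    also have "\<dots> \<le> ?d (s i) f + (?d f g + ?d g (t i))"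
      by (intro add_left_mono L1_triangle[OF fg sm(2)])
    also have "?d (s i) f = ?d f (s i)"
      by (rule L1_commute)
    finally show ?thesis .
  qed
  have "(\<lambda>i. ?d f (s i) + (?d f g + ?d g (t i))) \<longlonglongrightarrow> 0 + (?d f g + 0)"
    using s(2) t(2) by (intro tendsto_add tendsto_const)
  moreover have "(\<lambda>i. ennreal \<bar>simple_vector_integral \<mu> (s i) - simple_vector_integral \<mu> (t i)\<bar>)
      \<longlonglongrightarrow> ennreal \<bar>I - J\<bar>"
    using s(3) t(3) by (intro tendsto_ennrealI tendsto_rabs tendsto_diff)
  ultimately show ?thesis
    using LIMSEQ_le[of _ "ennreal \<bar>I - J\<bar>" _ "0 + (?d f g + 0)"] le by auto
qed

lemma has_vector_integral_unique:
  assumes "borel_vector_measure \<mu>" "f \<in> bmeasfun"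
    and "has_vector_integral \<mu> f I" "has_vector_integral \<mu> f J"
  shows "I = J"
  using has_vector_integral_dist_le[OF assms(1,2,2,3,4)] by simp


section \<open>Approximation by continuous functions\<close>

lemma bcontfun_imp_bmeasfun:
  fixes g :: "'o::topological_space \<Rightarrow>\<^sub>C 'x::real_normed_vector"
  assumes "compact (UNIV :: 'o set)"
  shows "apply_bcontfun g \<in> bmeasfun"
proof -
  have cont: "continuous_on UNIV (apply_bcontfun g)"
    by (rule continuous_on_apply_bcontfun)
  have comp: "compact (range (apply_bcontfun g))"
    using compact_continuous_image[OF cont assms] .
  have "\<forall>n. \<exists>F. finite F \<and> range (apply_bcontfun g) \<subseteq> (\<Union>d\<in>F. ball d (1 / Suc n))"
    using comp unfolding compact_eq_totally_bounded by (metis of_nat_0_less_iff zero_less_Suc zero_less_divide_1_iff)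
  then obtain F where F: "\<And>n. finite (F n)"
    "\<And>n. range (apply_bcontfun g) \<subseteq> (\<Union>d\<in>F n. ball d (1 / Suc n))"
    by metis
  have "separable_space (top_of_set (range (apply_bcontfun g)))"
  proof (rule separable_rangeI[of "\<Union>n. F n"])
    show "countable (\<Union>n. F n)"
      using F(1) by (intro countable_UN) (auto intro: countable_finite)
    fix x and e :: real assume "e > 0"
    then obtain n where n: "1 / Suc n < e"
      using nat_approx_posE by blast
    obtain d where "d \<in> F n" "dist d (apply_bcontfun g x) < 1 / Suc n"
      using F(2)[of n] by (auto simp: subset_iff)
    then show "\<exists>d\<in>\<Union>n. F n. dist d (apply_bcontfun g x) < e"
      using n by force
  qed
  then show ?thesis
    using cont compact_imp_bounded[OF comp]
    by (simp add: bmeasfun_def borel_measurable_continuous_onI)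
qed

text \<open>
  The radial retraction onto the ball of radius \<open>R\<close>. In a general normed space it is Lipschitz with
  constant 2, though not always nonexpansive.
\<close>

definition radial_retraction :: "real \<Rightarrow> 'x::real_normed_vector \<Rightarrow> 'x" where
  "radial_retraction R z = (R / max R (norm z)) *\<^sub>R z"

lemma norm_radial_retraction_le:
  assumes "R > 0"
  shows "norm (radial_retraction R z) \<le> R"
proof -
  have "norm (radial_retraction R z) = R * (norm z / max R (norm z))"
    using assms by (simp add: radial_retraction_def)
  also have "\<dots> \<le> R * 1"
    using assms by (intro mult_left_mono) (auto simp: divide_le_eq_1)
  finally show ?thesis by simp
qed

lemma continuous_on_radial_retraction:
  assumes "R > 0" "continuous_on S g"
  shows "continuous_on S (\<lambda>x. radial_retraction R (g x))"
  unfolding radial_retraction_def using assms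
  by (intro continuous_intros) (auto simp: max_def)

lemma radial_retraction_dist_le:
  assumes "R > 0" "norm w \<le> R"
  shows "norm (radial_retraction R z - w) \<le> 2 * norm (z - w)"
proof (cases "norm z \<le> R")
  case True
  then show ?thesis
    using assms by (simp add: radial_retraction_def max_absorb1)
next
  case False
  \<comment> \<open>The retraction moves \<open>z\<close> by its distance to the ball, and \<open>w\<close> lies in the ball.\<close>
  have "radial_retraction R z - z = (R / norm z - 1) *\<^sub>R z"
    using False by (simp add: radial_retraction_def max_absorb2 scaleR_diff_left)
  then have "norm (radial_retraction R z - z) = \<bar>R / norm z - 1\<bar> * norm z"
    by simp
  also have "\<dots> = norm z - R"
  proof -
    have "norm z > 0" "R / norm z \<le> 1"
      using False assms by (auto simp: divide_le_eq_1)
    then show ?thesis by (simp add: field_simps)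
  qed
  also have "\<dots> \<le> norm (z - w)"
    using assms norm_triangle_ineq2[of z w] by linarith
  finally show ?thesis
    using norm_diff_triangle_ineq[of "radial_retraction R z" 0 z w]
      norm_triangle_ineq[of "radial_retraction R z - z" "z - w"] by simp
qed

lemma compact_Hausdorff_Urysohn:
  fixes K U :: "'o::t2_space set"
  assumes "compact (UNIV :: 'o set)" "compact K" "open U" "K \<subseteq> U"
  obtains h :: "'o \<Rightarrow> real" where "continuous_on UNIV h" "\<And>x. 0 \<le> h x" "\<And>x. h x \<le> 1"
    "\<And>x. x \<in> K \<Longrightarrow> h x = 1" "\<And>x. x \<notin> U \<Longrightarrow> h x = 0"
proof -
  have "normal_space (euclidean :: 'o topology)"
  proof (rule compact_Hausdorff_or_regular_imp_normal_space)
    show "compact_space (euclidean :: 'o topology)"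
      using assms(1) by (simp add: compact_space_def)
    show "Hausdorff_space (euclidean :: 'o topology) \<or> regular_space (euclidean :: 'o topology)"
      using hausdorff by (auto simp: Hausdorff_space_def disjnt_def)
  qed
  moreover have "closedin euclidean (- U)" "closedin euclidean K" "disjnt (- U) K"
    using assms by (auto simp: disjnt_def compact_imp_closed closed_Compl)
  ultimately obtain h where h: "continuous_map euclidean (top_of_set {0..1::real}) h"
    "h ` (- U) \<subseteq> {0}" "h ` K \<subseteq> {1}"
    using Urysohn_lemma[of euclidean "- U" K 0 1] by auto
  then have "continuous_on UNIV h" "\<And>x. h x \<in> {0..1}"
    by (auto simp: continuous_map_in_subtopology)
  then show ?thesis
    using h(2,3) by (intro that[of h]) auto
qed

text \<open>
  Each level set \<open>A\<close> of the simple function lies between a compact \<open>K\<close> and an open \<open>U\<close> whose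
  difference has small variation; a Urysohn function for \<open>K \<subseteq> U\<close> differs from the indicator of \<open>A\<close>
  only on \<open>U - K\<close>, and there by at most 1.
\<close>

lemma simple_function_L1_approx_continuous:
  fixes s :: "'o::t2_space \<Rightarrow> 'x::real_normed_vector"
  assumes comp: "compact (UNIV :: 'o set)" and reg: "regular_borel_vector_measure \<mu>"
    and s: "simple_function borel s" and e: "e > 0"
  obtains g where "continuous_on UNIV g"
    "(\<integral>\<^sup>+ x. ennreal (norm (s x - g x)) \<partial>variation_measure \<mu>) \<le> ennreal e"
proof -
  note \<mu> = regular_borel_vector_measure_imp[OF reg]
  note fin = simple_function_borel_finite_range[OF s]
  define N where "N = (\<Sum>y\<in>range s. norm y)"
  define d where "d = e / (N + 1)"
  have N: "N \<ge> 0"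
    by (simp add: N_def sum_nonneg)
  then have d: "d > 0"
    using e by (simp add: d_def)
  have "\<exists>K U. compact K \<and> open U \<and> K \<subseteq> s -` {y} \<and> s -` {y} \<subseteq> U \<and> variation \<mu> (U - K) < ennreal d"
    for y
    using reg simple_function_borel_vimage[OF s] d
    unfolding regular_borel_vector_measure_def by simp
  then obtain K U where KU: "\<And>y. compact (K y)" "\<And>y. open (U y)" "\<And>y. K y \<subseteq> s -` {y}"
    "\<And>y. s -` {y} \<subseteq> U y" "\<And>y. variation \<mu> (U y - K y) < ennreal d"
    by metis
  have "\<exists>h::'o \<Rightarrow> real. continuous_on UNIV h \<and> (\<forall>x. 0 \<le> h x) \<and> (\<forall>x. h x \<le> 1) \<and>
      (\<forall>x\<in>K y. h x = 1) \<and> (\<forall>x. x \<notin> U y \<longrightarrow> h x = 0)" for y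
  proof -
    have "K y \<subseteq> U y"
      using KU(3,4) by blast
    from compact_Hausdorff_Urysohn[OF comp KU(1,2) this] show ?thesis
      by metis
  qed
  then obtain h where h: "\<And>y. continuous_on UNIV (h y)" "\<And>y x. 0 \<le> h y x" "\<And>y x. h y x \<le> (1::real)"
    "\<And>y x. x \<in> K y \<Longrightarrow> h y x = 1" "\<And>y x. x \<notin> U y \<Longrightarrow> h y x = 0"
    by metis
  define g where "g x = (\<Sum>y\<in>range s. h y x *\<^sub>R y)" for x
  have cont: "continuous_on UNIV g"
    unfolding g_def using h(1) by (intro continuous_intros) auto
  have meas: "U y - K y \<in> sets borel" for y
    using KU(1,2) by (intro sets.Diff borel_open borel_closed compact_imp_closed)
  have pt: "ennreal (norm (s x - g x)) \<le> (\<Sum>y\<in>range s. ennreal (norm y) * indicator (U y - K y) x)"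
    for x
  proof -
    have sx: "s x = (\<Sum>y\<in>range s. (indicator (s -` {y}) x :: real) *\<^sub>R y)"
    proof -
      have "(\<Sum>y\<in>range s. (indicator (s -` {y}) x :: real) *\<^sub>R y)
          = (\<Sum>y\<in>{s x}. (indicator (s -` {y}) x :: real) *\<^sub>R y)"
        using fin by (intro sum.mono_neutral_right) (auto simp: indicator_def)
      then show ?thesis by simp
    qed
    have "(\<Sum>y\<in>range s. (indicator (s -` {y}) x - h y x) *\<^sub>R y) = s x - g x"
      unfolding g_def scaleR_diff_left sum_subtractf by (simp only: sx[symmetric])
    then have "norm (s x - g x) \<le> (\<Sum>y\<in>range s. \<bar>indicator (s -` {y}) x - h y x\<bar> * norm y)"
      using norm_sum[of "\<lambda>y. (indicator (s -` {y}) x - h y x) *\<^sub>R y" "range s"] by simp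
    also have "\<dots> \<le> (\<Sum>y\<in>range s. norm y * indicator (U y - K y) x)"
    proof (rule sum_mono)
      fix y
      have "\<bar>indicator (s -` {y}) x - h y x\<bar> \<le> (indicator (U y - K y) x :: real)"
      proof (cases "x \<in> U y - K y")
        case True
        then show ?thesis
          using h(2)[of y x] h(3)[of y x] by (auto simp: indicator_def)
      next
        case False
        then have "x \<in> K y \<or> x \<notin> U y" by blast
        then have "indicator (s -` {y}) x = h y x"
          using KU(3,4)[of y] h(4)[of x y] h(5)[of x y] by (auto simp: indicator_def)
        then show ?thesis by simp
      qed
      then show "\<bar>indicator (s -` {y}) x - h y x\<bar> * norm y \<le> norm y * indicator (U y - K y) x"
        by (subst mult.commute) (intro mult_left_mono, auto)
    qed
    finally have "ennreal (norm (s x - g x))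
        \<le> ennreal (\<Sum>y\<in>range s. norm y * indicator (U y - K y) x)"
      by (rule ennreal_leI)
    also have "\<dots> = (\<Sum>y\<in>range s. ennreal (norm y) * indicator (U y - K y) x)"
      by (subst sum_ennreal[symmetric]) (auto simp: ennreal_mult ennreal_indicator)
    finally show ?thesis .
  qed
  have "(\<integral>\<^sup>+ x. ennreal (norm (s x - g x)) \<partial>variation_measure \<mu>)
      \<le> (\<integral>\<^sup>+ x. (\<Sum>y\<in>range s. ennreal (norm y) * indicator (U y - K y) x) \<partial>variation_measure \<mu>)"
    by (intro nn_integral_mono pt)
  also have "\<dots> = (\<Sum>y\<in>range s. ennreal (norm y) * variation \<mu> (U y - K y))"
    using meas by (subst nn_integral_sum)
      (auto simp: nn_integral_cmult_indicator emeasure_variation_measure[OF \<mu>])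
  also have "\<dots> \<le> (\<Sum>y\<in>range s. ennreal (norm y) * ennreal d)"
    using KU(5) by (intro sum_mono mult_left_mono) (auto intro: less_imp_le)
  also have "\<dots> = ennreal (N * d)"
    using d by (simp add: N_def ennreal_mult sum_nonneg flip: sum_distrib_right sum_ennreal)
  also have "\<dots> \<le> ennreal e"
    using e N by (intro ennreal_leI) (simp add: d_def field_simps)
  finally show ?thesis
    using that[OF cont] by blast
qed

text \<open>
  Density with control of the norm. A simple function and a continuous function close to \<open>f\<close> may
  exceed the bound \<open>R\<close> of \<open>f\<close>; since \<open>f\<close> itself is fixed by the radial retraction, applying it to the
  continuous function at most doubles the distance.
\<close>

lemma bmeasfun_L1_approx_bcontfun:
  fixes f :: "'o::t2_space \<Rightarrow> 'x::real_normed_vector"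
  assumes comp: "compact (UNIV :: 'o set)" and reg: "regular_borel_vector_measure \<mu>"
    and f: "f \<in> bmeasfun" and I: "has_vector_integral \<mu> f I"
    and R: "R > 0" "\<And>x. norm (f x) \<le> R" and e: "e > 0"
  obtains g :: "'o \<Rightarrow>\<^sub>C 'x" where "norm g \<le> R"
    "(\<integral>\<^sup>+ x. ennreal (norm (f x - apply_bcontfun g x)) \<partial>variation_measure \<mu>) \<le> ennreal e"
proof -
  let ?d = "\<lambda>f g. \<integral>\<^sup>+ x. ennreal (norm (f x - g x)) \<partial>variation_measure \<mu>"
  obtain s where s: "\<And>i::nat. simple_function borel (s i)" "(\<lambda>i. ?d f (s i)) \<longlonglongrightarrow> 0"
    using I by (auto simp: has_vector_integral_def)
  have "\<forall>\<^sub>F i in sequentially. ?d f (s i) < ennreal (e / 4)"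
    using s(2) e by (intro order_tendstoD) auto
  then obtain i where i: "?d f (s i) < ennreal (e / 4)"
    by (auto simp: eventually_sequentially)
  obtain k where k: "continuous_on UNIV k" "?d (s i) k \<le> ennreal (e / 4)"
    using simple_function_L1_approx_continuous[OF comp reg s(1)[of i], of "e / 4"] e by auto
  have bcont: "u \<in> bcontfun" if "continuous_on UNIV u" for u :: "'o \<Rightarrow> 'x"
    using that compact_imp_bounded[OF compact_continuous_image[OF that comp]] by (simp add: bcontfun_def)
  have k_meas: "k \<in> bmeasfun"
    using bcontfun_imp_bmeasfun[OF comp, of "Bcontfun k"] bcont[OF k(1)] by (simp add: Bcontfun_inverse)
  define g where "g = Bcontfun (\<lambda>x. radial_retraction R (k x))"
  have g: "apply_bcontfun g = (\<lambda>x. radial_retraction R (k x))"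
    unfolding g_def
    using bcont[OF continuous_on_radial_retraction[OF R(1) k(1)]] by (simp add: Bcontfun_inverse)
  have "norm g \<le> R"
    by (intro norm_bound) (simp add: g norm_radial_retraction_le R)
  moreover have "?d f (apply_bcontfun g) \<le> ennreal e"
  proof -
    have "?d f (apply_bcontfun g) \<le> (\<integral>\<^sup>+ x. 2 * ennreal (norm (f x - k x)) \<partial>variation_measure \<mu>)"
    proof (rule nn_integral_mono)
      fix x
      have "norm (f x - apply_bcontfun g x) \<le> 2 * norm (f x - k x)"
        using radial_retraction_dist_le[OF R(1) R(2), of "k x" x] by (simp add: g norm_minus_commute)
      then have "ennreal (norm (f x - apply_bcontfun g x)) \<le> ennreal (2 * norm (f x - k x))"
        by (rule ennreal_leI)
      then show "ennreal (norm (f x - apply_bcontfun g x)) \<le> 2 * ennreal (norm (f x - k x))"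
        by (simp add: ennreal_mult)
    qed
    also have "\<dots> = 2 * ?d f k"
    proof (rule nn_integral_cmult)
      have "(\<lambda>x. norm (f x - k x)) \<in> borel_measurable (variation_measure \<mu>)"
        using norm_diff_bmeasfun_measurable[OF f k_meas]
        by (simp add: measurable_cong_sets[OF sets_variation_measure refl])
      then show "(\<lambda>x. ennreal (norm (f x - k x))) \<in> borel_measurable (variation_measure \<mu>)"
        by (rule measurable_compose) simp
    qed
    also have "\<dots> \<le> 2 * (?d f (s i) + ?d (s i) k)"
      by (intro mult_left_mono L1_triangle f k_meas simple_function_imp_bmeasfun s(1)) simp
    also have "\<dots> \<le> 2 * (ennreal (e / 4) + ennreal (e / 4))"
      using i k(2) by (intro mult_left_mono add_mono) auto
    also have "\<dots> = ennreal (2 * (e / 4 + e / 4))"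
      using e by (subst ennreal_mult) (simp_all flip: ennreal_plus)
    also have "\<dots> = ennreal e"
      by simp
    finally show ?thesis .
  qed
  ultimately show ?thesis
    by (rule that)
qed


section \<open>The adjoints of an operator and of its extension\<close>

lemma adjoint_op_apply:
  "blinfun_apply (blinfun_apply (adjoint_op T) \<phi>) f = blinfun_apply \<phi> (blinfun_apply T f)"
  by (simp add: adjoint_op.rep_eq)

lemma representing_measureD:
  assumes "representing_measure m T"
  shows "regular_borel_vector_measure (slice_measure m \<phi>)"
    and "has_vector_integral (slice_measure m \<phi>) (apply_bcontfun g)
      (blinfun_apply \<phi> (blinfun_apply T g))"
  using assms by (auto simp: representing_measure_def has_operator_integral_def)

lemma bounded_borel_extensionD:
  assumes "bounded_borel_extension m T'"
  shows "has_vector_integral (slice_measure m \<phi>) (apply_bmeasfun f)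
      (blinfun_apply \<phi> (blinfun_apply T' f))"
  using assms by (auto simp: bounded_borel_extension_def has_operator_integral_def)

text \<open>
  A continuous function, viewed in \<open>B(\<Omega>, X)\<close>, has the same image under both operators because its
  integral is unique, and its norm does not grow under this embedding.
\<close>

lemma adjoint_norm_le_extension:
  fixes T :: "('o::topological_space \<Rightarrow>\<^sub>C 'x::real_normed_vector) \<Rightarrow>\<^sub>L 'y::real_normed_vector"
  assumes comp: "compact (UNIV :: 'o set)"
    and T: "representing_measure m T" and T': "bounded_borel_extension m T'"
  shows "norm (blinfun_apply (adjoint_op T) \<phi>) \<le> norm (blinfun_apply (adjoint_op T') \<phi>)"
proof (rule norm_blinfun_bound)
  fix g :: "'o \<Rightarrow>\<^sub>C 'x"
  define f where "f = Bmeasfun (apply_bcontfun g)"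
  have f: "apply_bmeasfun f = apply_bcontfun g"
    using bcontfun_imp_bmeasfun[OF comp, of g] by (simp add: f_def Bmeasfun_inverse)
  have "blinfun_apply \<phi> (blinfun_apply T g) = blinfun_apply \<phi> (blinfun_apply T' f)"
    using regular_borel_vector_measure_imp[OF representing_measureD(1)[OF T]]
      bcontfun_imp_bmeasfun[OF comp] representing_measureD(2)[OF T]
      bounded_borel_extensionD[OF T', of \<phi> f, unfolded f]
    by (rule has_vector_integral_unique)
  then have "norm (blinfun_apply (blinfun_apply (adjoint_op T) \<phi>) g)
      = norm (blinfun_apply (blinfun_apply (adjoint_op T') \<phi>) f)"
    by (simp add: adjoint_op_apply)
  also have "\<dots> \<le> norm (blinfun_apply (adjoint_op T') \<phi>) * norm f"
    by (rule norm_blinfun)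
  also have "\<dots> \<le> norm (blinfun_apply (adjoint_op T') \<phi>) * norm g"
    by (intro mult_left_mono norm_bmeasfun_le) (simp_all add: f norm_bounded)
  finally show "norm (blinfun_apply (blinfun_apply (adjoint_op T) \<phi>) g)
      \<le> norm (blinfun_apply (adjoint_op T') \<phi>) * norm g" .
qed simp

text \<open>
  A continuous \<open>g\<close> of norm at most about \<open>\<parallel>f\<parallel>\<close> that is close to \<open>f\<close> in \<open>L\<^sup>1\<close> has nearly the same integral
  as \<open>f\<close>, and the integral of \<open>g\<close> is \<open>\<phi> (T g)\<close>, bounded by \<open>\<parallel>\<phi> \<circ> T\<parallel> * \<parallel>g\<parallel>\<close>.
\<close>

lemma extension_adjoint_norm_le:
  fixes T :: "('o::t2_space \<Rightarrow>\<^sub>C 'x::real_normed_vector) \<Rightarrow>\<^sub>L 'y::real_normed_vector"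
  assumes comp: "compact (UNIV :: 'o set)"
    and T: "representing_measure m T" and T': "bounded_borel_extension m T'"
  shows "norm (blinfun_apply (adjoint_op T') \<phi>) \<le> norm (blinfun_apply (adjoint_op T) \<phi>)"
proof (rule norm_blinfun_bound)
  fix f :: "('o, 'x) bmeasfun"
  define C where "C = norm (blinfun_apply (adjoint_op T) \<phi>)"
  let ?I = "blinfun_apply \<phi> (blinfun_apply T' f)"
  note reg = representing_measureD(1)[OF T, of \<phi>]
  note I = bounded_borel_extensionD[OF T', of \<phi> f]
  \<comment> \<open>The radius exceeds \<open>\<parallel>f\<parallel>\<close> by \<open>e\<close> so that it stays positive when \<open>f = 0\<close>.\<close>
  have "\<bar>?I\<bar> \<le> C * (norm f + e) + e" if e: "e > 0" for e
  proof -
    have R: "norm f + e > 0" "\<And>x. norm (apply_bmeasfun f x) \<le> norm f + e"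
      using e norm_apply_bmeasfun_le[of f] by (auto simp: add_nonneg_pos intro: add_increasing2)
    obtain g :: "'o \<Rightarrow>\<^sub>C 'x" where g: "norm g \<le> norm f + e"
      "(\<integral>\<^sup>+ x. ennreal (norm (apply_bmeasfun f x - apply_bcontfun g x))
        \<partial>variation_measure (slice_measure m \<phi>)) \<le> ennreal e"
      using bmeasfun_L1_approx_bcontfun[OF comp reg apply_bmeasfun I R e] by blast
    let ?J = "blinfun_apply \<phi> (blinfun_apply T g)"
    have "ennreal \<bar>?I - ?J\<bar> \<le> ennreal e"
      using has_vector_integral_dist_le[OF regular_borel_vector_measure_imp[OF reg] apply_bmeasfun
          bcontfun_imp_bmeasfun[OF comp] I representing_measureD(2)[OF T]] g(2)
      by (rule order_trans)
    then have "\<bar>?I - ?J\<bar> \<le> e"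
      using e by (simp add: ennreal_le_iff)
    moreover have "\<bar>?J\<bar> \<le> C * norm g"
      using norm_blinfun[of "blinfun_apply (adjoint_op T) \<phi>" g] by (simp add: adjoint_op_apply C_def)
    moreover have "C * norm g \<le> C * (norm f + e)"
      using g(1) by (intro mult_left_mono) (auto simp: C_def)
    ultimately show ?thesis
      by linarith
  qed
  then have "\<forall>\<^sub>F e in at_right 0. \<bar>?I\<bar> \<le> C * (norm f + e) + e"
    by (simp add: eventually_at_right_less eventually_mono[OF eventually_at_right_less])
  moreover have "((\<lambda>e. C * (norm f + e) + e) \<longlongrightarrow> C * (norm f + 0) + 0) (at_right 0)"
    by (intro tendsto_intros)
  ultimately have "\<bar>?I\<bar> \<le> C * (norm f + 0) + 0"
    by (intro tendsto_lowerbound) auto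
  then show "norm (blinfun_apply (blinfun_apply (adjoint_op T') \<phi>) f)
      \<le> norm (blinfun_apply (adjoint_op T) \<phi>) * norm f"
    by (simp add: adjoint_op_apply C_def)
qed simp

theorem theorem4p4:
  fixes p :: real
    and T :: "('o::t2_space \<Rightarrow>\<^sub>C 'x::banach) \<Rightarrow>\<^sub>L 'y::banach"
    and m :: "'o set \<Rightarrow> ('x \<Rightarrow>\<^sub>L (('y \<Rightarrow>\<^sub>L real) \<Rightarrow>\<^sub>L real))"
    and T_hat :: "('o, 'x) bmeasfun \<Rightarrow>\<^sub>L 'y"
  assumes "1 \<le> p"
    and "compact (UNIV :: 'o set)"
    and "representing_measure m T"
    and "strongly_bounded m"
    and "bounded_borel_extension m T_hat"
  shows "Dunford_Pettis_p_convergent p (adjoint_op T) \<longleftrightarrow>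
         Dunford_Pettis_p_convergent p (adjoint_op T_hat)"
proof -
  have "norm (blinfun_apply (adjoint_op T) \<phi>) = norm (blinfun_apply (adjoint_op T_hat) \<phi>)" for \<phi>
    using adjoint_norm_le_extension[OF assms(2,3,5)] extension_adjoint_norm_le[OF assms(2,3,5)]
    by (rule antisym)
  then have "(\<lambda>n. blinfun_apply (adjoint_op T) (\<phi> n)) \<longlonglongrightarrow> 0 \<longleftrightarrow>
      (\<lambda>n. blinfun_apply (adjoint_op T_hat) (\<phi> n)) \<longlonglongrightarrow> 0" for \<phi> :: "nat \<Rightarrow> 'y \<Rightarrow>\<^sub>L real"
    using tendsto_norm_zero_iff[of "\<lambda>n. blinfun_apply (adjoint_op T) (\<phi> n)" sequentially]
      tendsto_norm_zero_iff[of "\<lambda>n. blinfun_apply (adjoint_op T_hat) (\<phi> n)" sequentially]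
    by simp
  then show ?thesis
    by (simp add: Dunford_Pettis_p_convergent_def)
qed

end
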